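(* For $L\in\mathbb{N}$, $\nu\in\mathbb{Z}_{> 0}$, $s = 0,1,\ldots,\nu-1$, and all integers $n\ge 2$, \[ G\left(L-2^{n-1}s-2^{n-2},\,L+2^{n-1}s+2^{n-2};\,\frac{(\frac{2^{2n}-1}{3}\nu+\frac{2^{2n-1}+1}{3})(\nu+s+1)}{2^{n-2}(2\nu+1)},\,\frac{(\frac{2^{2n}-1}{3}\nu+\frac{2^{2n-1}+1}{3})(\nu-s)}{2^{n-2}(2\nu+1)},\,2^{n-1}(2\nu+1)\right)\ge 0. \]
   Context: The $q$-binomial coefficient is $\begin{bmatrix}m\\ n\end{bmatrix}_q=\frac{(q;q)_m}{(q;q)_n(q;q)_{m-n}}$ for $m\ge n\ge 0$ and $0$ otherwise, where $(a;q)_L=\prod_{k=0}^{L-1}(1-aq^k)$. Define \[ G(N,M;\alpha,\beta,K)=\sum_{j\in\mathbb{Z}}(-1)^jq^{\frac{1}{2}Kj((\alpha+\beta)j+\alpha-\beta)}\begin{bmatrix}M+N\\ N-Kj\end{bmatrix}_{q}. \] "$P(q)\ge 0$" means the power series $P(q)$ has non-negative coefficients. *)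

theory Defs
  imports "HOL-Computational_Algebra.Polynomial"
begin

definition qpoch :: "nat \<Rightarrow> rat poly" where
  "qpoch L = (\<Prod>k<L. 1 - monom 1 (k + 1))"

definition qbinom :: "int \<Rightarrow> int \<Rightarrow> rat poly" where
  "qbinom m k = (if 0 \<le> k \<and> k \<le> m
      then qpoch (nat m) div (qpoch (nat k) * qpoch (nat (m - k)))
      else 0)"

definition G_exp :: "rat \<Rightarrow> rat \<Rightarrow> int \<Rightarrow> int \<Rightarrow> rat" where
  "G_exp \<alpha> \<beta> K j = of_int K * of_int j * ((\<alpha> + \<beta>) * of_int j + \<alpha> - \<beta>) / 2"

text \<open>Coefficient of q^e in G(N,M;alpha,beta,K) (exponents e are allowed to be rational;
  only finitely many j contribute since the q-binomial vanishes otherwise, for K \<noteq> 0).\<close>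
definition G_coeff :: "int \<Rightarrow> int \<Rightarrow> rat \<Rightarrow> rat \<Rightarrow> int \<Rightarrow> rat \<Rightarrow> rat" where
  "G_coeff N M \<alpha> \<beta> K e =
     (\<Sum>j\<in>{j::int. 0 \<le> N - K * j \<and> N - K * j \<le> M + N}.
        (-1) ^ nat \<bar>j\<bar> *
        (if e - G_exp \<alpha> \<beta> K j \<in> \<nat>
         then coeff (qbinom (M + N) (N - K * j)) (nat \<lfloor>e - G_exp \<alpha> \<beta> K j\<rfloor>)
         else 0))"

definition G_nonneg :: "int \<Rightarrow> int \<Rightarrow> rat \<Rightarrow> rat \<Rightarrow> int \<Rightarrow> bool" where
  "G_nonneg N M \<alpha> \<beta> K \<longleftrightarrow> (\<forall>e. G_coeff N M \<alpha> \<beta> K e \<ge> 0)"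

end

theory Submission
  imports Defs
begin

text \<open>
  Write \<open>K = 2 \<nu> + 1\<close>, \<open>b = K j + s\<close> and \<open>T b = b (b + 1) / 2\<close>. The signed sums of
  \<open>(-1)^j q^(j (K j + 2 s + 1) / 2) [k; floor ((k - b) / 2)]\<close> (the finite Andrews--Gordon sums of
  Foda and Quano) have non-negative coefficients: they are the case \<open>\<alpha> = \<beta> = 1\<close> of the hook
  difference polynomials, which satisfy subtraction-free recurrences that only change
  \<open>(\<alpha>, \<beta>)\<close> to \<open>(0, 2)\<close>, \<open>(1, 1)\<close> or \<open>(2, 0)\<close>.

  Iterating the \<open>q\<close>-Vandermonde summation writes \<open>q^(T b) [2 L + 1; L - b]\<close> as a combination of the
  \<open>[k; floor ((k - b) / 2)]\<close>, and \<open>q^(floor (a^2 / 2)) [2 L; L - a]\<close> as a combination of the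
  \<open>[k; (k - a) / 2]\<close> with \<open>k \<equiv> a (mod 2)\<close>. In both cases the coefficients do not depend on \<open>b\<close>
  or \<open>a\<close> and are non-negative, so positivity is inherited. Applying the first transformation once
  and then the second one to \<open>a = 2 b + 1, 2 (2 b + 1), \<dots>, 2^(n-2) (2 b + 1)\<close> accumulates
  exactly the exponent of the theorem, up to a factor independent of \<open>j\<close>.
\<close>

section \<open>Gaussian binomials\<close>

definition q :: "rat poly" where "q = monom 1 1"

lemma q_power: "q ^ e = monom 1 e"
  by (simp add: q_def monom_power)

text \<open>Pascal's rule taken as definition avoids division, so vanishing and non-negativity
  follow by induction; \<open>qbinom_nat\<close> identifies it with the quotient.\<close>

fun gauss :: "nat \<Rightarrow> nat \<Rightarrow> rat poly" where
  "gauss m 0 = 1"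
| "gauss 0 (Suc k) = 0"
| "gauss (Suc m) (Suc k) = gauss m k + q ^ Suc k * gauss m (Suc k)"

lemma gauss_eq_0: "m < k \<Longrightarrow> gauss m k = 0"
  by (induction m k rule: gauss.induct) auto

lemma qpoch_Suc: "qpoch (Suc m) = qpoch m * (1 - q ^ Suc m)"
  by (simp add: qpoch_def q_power del: power_Suc)

lemma qpoch_0 [simp]: "qpoch 0 = 1"
  by (simp add: qpoch_def)

lemma qpoch_nonzero [simp]: "qpoch m \<noteq> 0"
proof (induction m)
  case (Suc m)
  have "coeff (1 - q ^ Suc m) 0 = 1"
    by (simp add: q_power del: power_Suc)
  then have "1 - q ^ Suc m \<noteq> 0"
    by (metis coeff_0 zero_neq_one)
  with Suc show ?case
    by (simp only: qpoch_Suc mult_eq_0_iff) simp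
qed simp

text \<open>In the Pascal step the factors combine by
  \<open>(1 - q ^ k) + q ^ k * (1 - q ^ l) = 1 - q ^ (k + l)\<close>.\<close>

lemma gauss_mult_qpoch: "gauss (k + l) k * (qpoch k * qpoch l) = qpoch (k + l)"
proof (induction "k + l" arbitrary: k l)
  case (Suc m)
  show ?case
  proof (cases k)
    case 0
    then show ?thesis by simp
  next
    case k: (Suc k')
    then have m: "m = k' + l" using Suc.hyps(2) by simp
    have 1: "gauss m k' * (qpoch k' * qpoch l) = qpoch m"
      using Suc.hyps(1)[of k' l] m by simp
    \<comment> \<open>The induction hypothesis needs \<open>l > 0\<close>; for \<open>l = 0\<close>
      both sides vanish because \<open>m < k\<close>.\<close>
    have 2: "gauss m k * (qpoch k * qpoch l) = qpoch m * (1 - q ^ l)"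
    proof (cases l)
      case 0
      then show ?thesis using m k by (simp add: gauss_eq_0)
    next
      case (Suc l')
      with m k have "m = k + l'" by simp
      with Suc.hyps(1)[of k l'] have "gauss m k * (qpoch k * qpoch l') = qpoch m" by simp
      then show ?thesis unfolding Suc qpoch_Suc by (simp add: mult.assoc[symmetric])
    qed
    have "gauss (k + l) k * (qpoch k * qpoch l)
        = gauss m k' * (qpoch k' * qpoch l) * (1 - q ^ k) + q ^ k * (gauss m k * (qpoch k * qpoch l))"
      unfolding k m by (simp add: qpoch_Suc algebra_simps)
    also have "\<dots> = qpoch m * (1 - q ^ (k + l))"
      unfolding 1 2 by (simp add: algebra_simps power_add)
    also have "\<dots> = qpoch (k + l)"
      using Suc.hyps(2) by (metis qpoch_Suc)
    finally show ?thesis .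
  qed
qed simp

lemma qbinom_nat: "qbinom (int m) (int k) = gauss m k"
proof (cases "k \<le> m")
  case True
  then obtain l where l: "m = k + l" using le_Suc_ex by blast
  have "nat (int m - int k) = l" using l by simp
  then show ?thesis
    using nonzero_mult_div_cancel_right[of "qpoch k * qpoch l" "gauss (k + l) k"] gauss_mult_qpoch[of k l]
    by (simp add: qbinom_def l nat_add_distrib flip: of_nat_add)
next
  case False
  then show ?thesis by (simp add: qbinom_def gauss_eq_0)
qed

lemma gauss_symmetric: "gauss (k + l) k = gauss (k + l) l"
proof -
  have "gauss (k + l) k * (qpoch k * qpoch l) = gauss (k + l) l * (qpoch k * qpoch l)"
    using gauss_mult_qpoch[of k l] gauss_mult_qpoch[of l k] by (simp add: ac_simps)
  then show ?thesis by simp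
qed

text \<open>The defining rule reflected by \<open>gauss_symmetric\<close>.\<close>

lemma gauss_Suc_Suc': "gauss (Suc m) (Suc k) = gauss m (Suc k) + q ^ (m - k) * gauss m k"
proof (cases "k < m")
  case True
  then obtain l where l: "m = Suc (k + l)" using less_iff_Suc_add by blast
  have "gauss (Suc m) (Suc k) = gauss (Suc k + Suc l) (Suc l)"
    using gauss_symmetric[of "Suc k" "Suc l"] by (simp only: l add_Suc add_Suc_right)
  also have "\<dots> = gauss m l + q ^ Suc l * gauss m (Suc l)"
    by (simp add: l)
  also have "gauss m l = gauss m (Suc k)"
    using gauss_symmetric[of l "Suc k"] by (simp add: l add.commute)
  also have "gauss m (Suc l) = gauss m k"
    using gauss_symmetric[of "Suc l" k] by (simp add: l add.commute)
  finally show ?thesis using l by simp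
next
  case False
  then show ?thesis
    by (cases "k = m") (simp_all add: gauss_eq_0)
qed

lemma gauss_Vandermonde:
  "gauss (m + n) r = (\<Sum>a\<le>r. q ^ ((m - a) * (r - a)) * (gauss m a * gauss n (r - a)))"
proof (induction n arbitrary: r)
  case 0
  have "(\<Sum>a\<le>r. q ^ ((m - a) * (r - a)) * (gauss m a * gauss 0 (r - a)))
     = (\<Sum>a\<in>{r}. q ^ ((m - a) * (r - a)) * (gauss m a * gauss 0 (r - a)))"
    by (rule sum.mono_neutral_right) (auto simp: gauss_eq_0)
  then show ?case by simp
next
  case (Suc n)
  show ?case
  proof (cases r)
    case 0
    then show ?thesis by simp
  next
    case r: (Suc r')
    have *: "q ^ ((m - a) * (r - a)) * (gauss m a * gauss (Suc n) (r - a)) =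
        q ^ ((m - a) * (r - a)) * (gauss m a * gauss n (r - a))
        + q ^ (m + n - r') * (q ^ ((m - a) * (r' - a)) * (gauss m a * gauss n (r' - a)))"
      if "a \<le> r'" for a
    proof -
      from that have ra: "r - a = Suc (r' - a)" using r by simp
      \<comment> \<open>Natural subtraction breaks the exponent identity outside
        \<open>a \<le> m\<close>, \<open>r' - a \<le> n\<close>, but there a Gaussian factor is
        zero.\<close>
      have "q ^ ((m - a) * (r - a) + (n - (r' - a))) * (gauss m a * gauss n (r' - a))
         = q ^ (m + n - r' + (m - a) * (r' - a)) * (gauss m a * gauss n (r' - a))"
      proof (cases "a \<le> m \<and> r' - a \<le> n")
        case True
        then have "(m - a) * (r - a) + (n - (r' - a)) = m + n - r' + (m - a) * (r' - a)"
          using that unfolding ra by (auto simp: le_iff_add)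
        then show ?thesis by simp
      next
        case False
        then show ?thesis by (auto simp: gauss_eq_0)
      qed
      then show ?thesis
        unfolding ra gauss_Suc_Suc' by (simp add: algebra_simps power_add)
    qed
    have "gauss (m + Suc n) r = gauss (m + n) r + q ^ (m + n - r') * gauss (m + n) r'"
      by (simp only: r add_Suc_right gauss_Suc_Suc')
    also have "\<dots> = (\<Sum>a\<le>r'. q ^ ((m - a) * (r - a)) * (gauss m a * gauss (Suc n) (r - a)))
        + q ^ ((m - r) * (r - r)) * (gauss m r * gauss (Suc n) (r - r))"
    proof -
      have "(\<Sum>a\<le>r'. q ^ ((m - a) * (r - a)) * (gauss m a * gauss (Suc n) (r - a)))
          = (\<Sum>a\<le>r'. q ^ ((m - a) * (r - a)) * (gauss m a * gauss n (r - a)))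
            + q ^ (m + n - r') * gauss (m + n) r'"
        unfolding Suc.IH[of r'] sum_distrib_left sum.distrib[symmetric]
        by (rule sum.cong[OF refl], rule *) simp
      then show ?thesis
        unfolding Suc.IH[of r] by (simp add: r)
    qed
    also have "\<dots> = (\<Sum>a\<le>r. q ^ ((m - a) * (r - a)) * (gauss m a * gauss (Suc n) (r - a)))"
      by (simp add: r)
    finally show ?thesis .
  qed
qed

text \<open>Vandermonde with \<open>r = m - c\<close>, summed over \<open>b = r - a\<close> and with
  the first factor reflected. Any bound \<open>B \<ge> n\<close> serves, since further terms
  vanish.\<close>

lemma gauss_Vandermonde':
  assumes "c \<le> m" "n \<le> B"
  shows "(\<Sum>b\<le>B. q ^ (b * (b + c)) * (gauss m (b + c) * gauss n b)) = gauss (m + n) (m - c)"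
proof -
  obtain r where m: "m = r + c" using assms by (metis add.commute le_Suc_ex)
  have "gauss (m + n) r = (\<Sum>b\<le>r. q ^ ((m - (r - b)) * (r - (r - b))) * (gauss m (r - b) * gauss n (r - (r - b))))"
    unfolding gauss_Vandermonde
    by (rule sum.reindex_bij_witness[of _ "\<lambda>b. r - b" "\<lambda>b. r - b"]) auto
  also have "\<dots> = (\<Sum>b\<le>r. q ^ (b * (b + c)) * (gauss m (b + c) * gauss n b))"
  proof (rule sum.cong[OF refl])
    fix b assume "b \<in> {..r}"
    then obtain d where "r = d + b" by (metis atMost_iff add.commute le_Suc_ex)
    then show "q ^ ((m - (r - b)) * (r - (r - b))) * (gauss m (r - b) * gauss n (r - (r - b)))
        = q ^ (b * (b + c)) * (gauss m (b + c) * gauss n b)"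
      using gauss_symmetric[of d "b + c"] by (simp add: m mult.commute add.assoc)
  qed
  also have "\<dots> = (\<Sum>b\<le>max r B. q ^ (b * (b + c)) * (gauss m (b + c) * gauss n b))"
    by (rule sum.mono_neutral_left) (auto simp: m gauss_eq_0)
  also have "\<dots> = (\<Sum>b\<le>B. q ^ (b * (b + c)) * (gauss m (b + c) * gauss n b))"
    using assms by (intro sum.mono_neutral_right) (auto simp: gauss_eq_0)
  finally show ?thesis using m by simp
qed

text \<open>Both sides are the \<open>q\<close>-multinomial coefficient with parts \<open>m\<close>,
  \<open>u\<close>, \<open>v\<close>, \<open>w\<close>.\<close>

lemma gauss_trinomial:
  "gauss (m + u + v + w) (u + v) * (gauss (m + w) m * gauss (u + v) v)
    = gauss (m + u + v + w) (m + u) * (gauss (m + u) m * gauss (v + w) v)"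
proof -
  let ?P = "qpoch m * qpoch u * qpoch v * qpoch w"
  have "gauss (m + u + v + w) (u + v) * (gauss (m + w) m * gauss (u + v) v) * ?P
     = gauss (u + v + (m + w)) (u + v) *
       ((gauss (v + u) v * (qpoch v * qpoch u)) * (gauss (m + w) m * (qpoch m * qpoch w)))"
    by (simp add: ac_simps)
  also have "\<dots> = qpoch (m + u + v + w)"
    unfolding gauss_mult_qpoch using gauss_mult_qpoch[of "u + v" "m + w"] by (simp add: ac_simps)
  also have "\<dots> = gauss (m + u + (v + w)) (m + u) *
       ((gauss (m + u) m * (qpoch m * qpoch u)) * (gauss (v + w) v * (qpoch v * qpoch w)))"
    unfolding gauss_mult_qpoch by (simp add: add.assoc)
  also have "\<dots> = gauss (m + u + v + w) (m + u) * (gauss (m + u) m * gauss (v + w) v) * ?P"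
    by (simp add: ac_simps)
  finally show ?thesis by simp
qed

section \<open>Hook difference polynomials\<close>

definition nonneg_poly :: "rat poly \<Rightarrow> bool" where
  "nonneg_poly p \<longleftrightarrow> (\<forall>e. 0 \<le> coeff p e)"

lemma nonneg_poly_0 [simp]: "nonneg_poly 0"
  by (simp add: nonneg_poly_def)

lemma nonneg_poly_1 [simp]: "nonneg_poly 1"
  by (simp add: nonneg_poly_def coeff_1)

lemma nonneg_poly_add: "nonneg_poly p \<Longrightarrow> nonneg_poly r \<Longrightarrow> nonneg_poly (p + r)"
  by (simp add: nonneg_poly_def)

lemma nonneg_poly_mult: "nonneg_poly p \<Longrightarrow> nonneg_poly r \<Longrightarrow> nonneg_poly (p * r)"
  by (simp add: nonneg_poly_def coeff_mult sum_nonneg)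

lemma nonneg_poly_sum: "(\<And>a. a \<in> A \<Longrightarrow> nonneg_poly (f a)) \<Longrightarrow> nonneg_poly (sum f A)"
  by (simp add: nonneg_poly_def coeff_sum sum_nonneg)

lemma nonneg_poly_q_power [simp]: "nonneg_poly (q ^ e)"
  by (simp add: nonneg_poly_def q_power)

lemma nonneg_poly_q_power_cancel:
  assumes "nonneg_poly (q ^ e * p)"
  shows "nonneg_poly p"
  unfolding nonneg_poly_def
proof
  fix d
  have "0 \<le> coeff (q ^ e * p) (e + d)"
    using assms by (simp add: nonneg_poly_def)
  then show "0 \<le> coeff p d"
    by (simp add: q_power coeff_monom_mult)
qed

lemma nonneg_poly_gauss [simp]: "nonneg_poly (gauss m k)"
  by (induction m k rule: gauss.induct)
    (auto intro!: nonneg_poly_add nonneg_poly_mult simp del: power_Suc)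

section \<open>Gaussian binomials and powers with integer arguments\<close>

lemma qbinom_eq_0: "k < 0 \<or> m < k \<Longrightarrow> qbinom m k = 0"
  by (auto simp: qbinom_def)

lemma nonneg_poly_qbinom [simp]: "nonneg_poly (qbinom (int m) k)"
  by (cases "0 \<le> k") (use qbinom_nat[of m "nat k"] in \<open>auto simp: qbinom_eq_0\<close>)

lemma qbinom_symmetric: "qbinom m (m - k) = qbinom m k"
  by (auto simp: qbinom_def mult.commute)

text \<open>Integer exponents permit ring algebra; negative ones are truncated to
  \<open>q ^ 0\<close>, which is why exponent signs are checked throughout.\<close>

definition qpow :: "int \<Rightarrow> rat poly" where "qpow e = q ^ nat e"

lemma qpow_add: "0 \<le> a \<Longrightarrow> 0 \<le> b \<Longrightarrow> qpow (a + b) = qpow a * qpow b"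
  by (simp add: qpow_def nat_add_distrib power_add)

lemma nonneg_poly_qpow [simp]: "nonneg_poly (qpow e)"
  by (simp add: qpow_def)

text \<open>The prefactor \<open>qpow e\<close> is carried along so that \<open>k\<close> may be
  negative: a truncated \<open>qpow (e + k)\<close> then multiplies zero.\<close>

lemma qbinom_Pascal1:
  assumes "0 \<le> e"
  shows "qpow e * qbinom (int (Suc m)) k
    = qpow e * qbinom (int m) (k - 1) + qpow (e + k) * qbinom (int m) k"
proof (cases "1 \<le> k")
  case True
  define k' where "k' = nat (k - 1)"
  have k: "k = int (Suc k')" "k - 1 = int k'" using True by (simp_all add: k'_def)
  have "qpow (e + k) = qpow e * q ^ Suc k'"
    using assms by (subst qpow_add) (simp_all add: k(1) qpow_def nat_add_distrib)
  then show ?thesis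
    unfolding k(2) by (simp only: k(1) qbinom_nat gauss.simps distrib_left mult.assoc)
next
  case False
  then consider "k = 0" | "k < 0" by linarith
  then show ?thesis
  proof cases
    case 1
    then show ?thesis
      using qbinom_nat[of "Suc m" 0] qbinom_nat[of m 0] by (simp add: qbinom_eq_0)
  qed (simp add: qbinom_eq_0)
qed

lemma qbinom_Pascal2:
  assumes "0 \<le> e"
  shows "qpow e * qbinom (int (Suc m)) k
    = qpow e * qbinom (int m) k + qpow (e + int (Suc m) - k) * qbinom (int m) (k - 1)"
  using qbinom_Pascal1[OF assms, of m "int (Suc m) - k"]
    qbinom_symmetric[of "int m" k] qbinom_symmetric[of "int m" "k - 1"]
  by (simp add: qbinom_symmetric[of "1 + int m"] algebra_simps)

text \<open>The hook difference polynomial \<open>D_{K,i}(N, M; \<alpha>, \<beta>)\<close> of Andrews, Baxter, Bressoud, Burge,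
  Forrester and Viennot for \<open>\<alpha> = 2 - \<beta>\<close> and \<open>M = m - N\<close>, with the bilateral sum cut off at \<open>B\<close>.\<close>

definition hook_poly :: "nat \<Rightarrow> int \<Rightarrow> int \<Rightarrow> int \<Rightarrow> nat \<Rightarrow> int \<Rightarrow> rat poly" where
  "hook_poly B K i \<beta> m N =
     (\<Sum>j\<in>{- int B..int B}. qpow (j * (2 * K * j + 2 * i - K * \<beta>)) * qbinom (int m) (N - K * j)
        - qpow ((K * j - i) * (2 * j - \<beta>)) * qbinom (int m) (N - K * j + i))"

context
  fixes K i :: int
  assumes i: "0 < i" "i < K"
begin

lemma mult_K_bounds:
  "1 \<le> j \<Longrightarrow> K \<le> K * j" "j \<le> 0 \<Longrightarrow> K * j \<le> 0" "j \<le> -1 \<Longrightarrow> K * j \<le> - K"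
  "0 \<le> j \<Longrightarrow> 0 \<le> K * j"
proof -
  show "1 \<le> j \<Longrightarrow> K \<le> K * j" using i mult_left_mono[of 1 j K] by simp
  show "j \<le> 0 \<Longrightarrow> K * j \<le> 0" using i mult_left_mono[of j 0 K] by simp
  show "j \<le> -1 \<Longrightarrow> K * j \<le> - K" using i mult_left_mono[of j "-1" K] by simp
  show "0 \<le> j \<Longrightarrow> 0 \<le> K * j" using i by simp
qed

text \<open>The two factors have the same sign because \<open>0 < i < K\<close> and
  \<open>0 \<le> K * \<beta> \<le> 2 * K\<close>; hence \<open>qpow\<close> never truncates in
  \<open>hook_poly\<close>.\<close>

lemma hook_exponent1_nonneg:
  assumes "0 \<le> \<beta>" "\<beta> \<le> 2"
  shows "0 \<le> j * (2 * K * j + 2 * i - K * \<beta>)"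
proof -
  have \<beta>: "0 \<le> K * \<beta>" "K * \<beta> \<le> 2 * K" using i assms by (simp_all add: mult.commute)
  consider "1 \<le> j" | "j = 0" | "j \<le> -1" by linarith
  then show ?thesis
  proof cases
    case 1
    then have "0 \<le> 2 * (K * j) + 2 * i - K * \<beta>" using mult_K_bounds(1)[of j] i \<beta> by linarith
    with 1 show ?thesis by (simp add: mult.assoc)
  next
    case 3
    then have "2 * (K * j) + 2 * i - K * \<beta> \<le> 0" using mult_K_bounds(3)[of j] i \<beta> by linarith
    with 3 show ?thesis by (intro mult_nonpos_nonpos) (simp_all add: mult.assoc)
  qed simp
qed

lemma hook_exponent2_nonneg:
  assumes "0 \<le> \<beta>" "\<beta> \<le> 2"
  shows "0 \<le> (K * j - i) * (2 * j - \<beta>)"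
proof (cases "1 \<le> j")
  case True
  then show ?thesis using mult_K_bounds(1)[of j] i assms by (intro mult_nonneg_nonneg) linarith+
next
  case False
  then show ?thesis using mult_K_bounds(2)[of j] i assms by (intro mult_nonpos_nonpos) linarith+
qed

text \<open>Pascal's first rule adds the lower index to the exponent; its \<open>j\<close>-dependent
  part turns \<open>\<beta>\<close> into \<open>\<beta> + 1\<close> in both sums, leaving the common
  factor \<open>qpow N\<close>.\<close>

lemma hook_poly_rec1:
  assumes "0 \<le> N" "0 \<le> \<beta>" "\<beta> \<le> 1"
  shows "hook_poly B K i \<beta> (Suc m) N
    = hook_poly B K i \<beta> m (N - 1) + qpow N * hook_poly B K i (\<beta> + 1) m N"
proof -
  have 1: "qpow (j * (2 * K * j + 2 * i - K * \<beta>) + (N - K * j))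
      = qpow N * qpow (j * (2 * K * j + 2 * i - K * (\<beta> + 1)))" for j
    using assms hook_exponent1_nonneg[of "\<beta> + 1" j]
    by (subst qpow_add[symmetric]) (simp_all add: algebra_simps)
  have 2: "qpow ((K * j - i) * (2 * j - \<beta>) + (N - K * j + i))
      = qpow N * qpow ((K * j - i) * (2 * j - (\<beta> + 1)))" for j
    using assms hook_exponent2_nonneg[of "\<beta> + 1" j]
    by (subst qpow_add[symmetric]) (simp_all add: algebra_simps)
  have \<beta>: "0 \<le> \<beta>" "\<beta> \<le> 2" using assms by auto
  have s: "N - 1 - x = N - x - 1" "N - x - 1 + y = N - x + y - 1" for x y :: int by auto
  show ?thesis
    unfolding hook_poly_def sum_distrib_left sum.distrib[symmetric]
      qbinom_Pascal1[OF hook_exponent1_nonneg[OF \<beta>]] qbinom_Pascal1[OF hook_exponent2_nonneg[OF \<beta>]]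
    unfolding 1 2 s
    by (intro sum.cong) (simp_all add: right_diff_distrib mult.assoc)
qed

text \<open>The mirror image: Pascal's second rule adds the complementary index and so lowers
  \<open>\<beta>\<close> by one.\<close>

lemma hook_poly_rec2:
  assumes "N \<le> int (Suc m)" "1 \<le> \<beta>" "\<beta> \<le> 2"
  shows "hook_poly B K i \<beta> (Suc m) N
    = hook_poly B K i \<beta> m N + qpow (int (Suc m) - N) * hook_poly B K i (\<beta> - 1) m (N - 1)"
proof -
  have 1: "qpow (j * (2 * K * j + 2 * i - K * \<beta>) + int (Suc m) - (N - K * j))
      = qpow (int (Suc m) - N) * qpow (j * (2 * K * j + 2 * i - K * (\<beta> - 1)))" for j
    using assms hook_exponent1_nonneg[of "\<beta> - 1" j]
    by (subst qpow_add[symmetric]) (simp_all add: algebra_simps)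
  have 2: "qpow ((K * j - i) * (2 * j - \<beta>) + int (Suc m) - (N - K * j + i))
      = qpow (int (Suc m) - N) * qpow ((K * j - i) * (2 * j - (\<beta> - 1)))" for j
    using assms hook_exponent2_nonneg[of "\<beta> - 1" j]
    by (subst qpow_add[symmetric]) (simp_all add: algebra_simps)
  have \<beta>: "0 \<le> \<beta>" "\<beta> \<le> 2" using assms by auto
  have s: "N - 1 - x = N - x - 1" "N - x - 1 + y = N - x + y - 1" for x y :: int by auto
  show ?thesis
    unfolding hook_poly_def sum_distrib_left sum.distrib[symmetric]
      qbinom_Pascal2[OF hook_exponent1_nonneg[OF \<beta>]] qbinom_Pascal2[OF hook_exponent2_nonneg[OF \<beta>]]
    unfolding 1 2 s
    by (intro sum.cong) (simp_all add: right_diff_distrib mult.assoc)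
qed

text \<open>In the strip, \<open>N < 0\<close> forces \<open>N + i > m\<close>, and
  \<open>N > m\<close> forces \<open>N - K + i < 0\<close>; all other lower indices lie still
  further out.\<close>

lemma hook_poly_eq_0_outside:
  assumes "\<beta> - i \<le> 2 * N - int m" "2 * N - int m \<le> K - 2 + \<beta> - i" "0 \<le> \<beta>" "\<beta> \<le> 2"
    and "N < 0 \<or> int m < N"
  shows "hook_poly B K i \<beta> m N = 0"
proof -
  have "qbinom (int m) (N - K * j) = 0 \<and> qbinom (int m) (N - K * j + i) = 0" for j
  proof -
    consider "1 \<le> j" | "j = 0" | "j \<le> -1" by linarith
    then have "(N - K * j < 0 \<or> int m < N - K * j) \<and> (N - K * j + i < 0 \<or> int m < N - K * j + i)"
    proof cases
      case 1
      then show ?thesis using mult_K_bounds(1)[of j] assms i by linarith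
    next
      case 2
      then show ?thesis using assms i by auto
    next
      case 3
      then show ?thesis using mult_K_bounds(3)[of j] assms i by linarith
    qed
    then show ?thesis by (simp add: qbinom_eq_0)
  qed
  then show ?thesis by (simp add: hook_poly_def)
qed

text \<open>On this edge the reflection \<open>j \<mapsto> - j\<close> matches the two sums term by
  term.\<close>

lemma hook_poly_eq_0_lower:
  assumes "2 * N - int m = - i"
  shows "hook_poly B K i 0 m N = 0"
proof -
  have "(\<Sum>j\<in>{- int B..int B}. qpow (j * (2 * K * j + 2 * i - K * 0)) * qbinom (int m) (N - K * j))
    = (\<Sum>j\<in>{- int B..int B}. qpow ((K * j - i) * (2 * j - 0)) * qbinom (int m) (N - K * j + i))"
  proof (rule sum.reindex_bij_witness[of _ uminus uminus])
    fix j :: int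
    have "int m - (N - K * - j + i) = N - K * j" using assms by simp
    then show "qpow ((K * - j - i) * (2 * - j - 0)) * qbinom (int m) (N - K * - j + i)
      = qpow (j * (2 * K * j + 2 * i - K * 0)) * qbinom (int m) (N - K * j)"
      using qbinom_symmetric[of "int m" "N - K * - j + i"] by (simp add: algebra_simps)
  qed auto
  then show ?thesis by (simp add: hook_poly_def sum_subtractf)
qed

text \<open>Here the matching reflection is \<open>j \<mapsto> 1 - j\<close>.\<close>

lemma hook_poly_eq_0_upper:
  assumes "2 * N - int m = K - i" "0 \<le> N" "N \<le> int m" "m < B"
  shows "hook_poly B K i 2 m N = 0"
proof -
  let ?g = "\<lambda>j. qpow (j * (2 * K * j + 2 * i - K * 2)) * qbinom (int m) (N - K * j)"
  have B: "int B \<le> K * int B" using i mult_right_mono[of 1 K "int B"] by simp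
  \<comment> \<open>The reflection does not preserve the range: it drops \<open>- int B\<close> and
    gains \<open>int B + 1\<close>. Both terms are zero because
    \<open>K * B \<ge> B > m\<close>.\<close>
  have 1: "?g j = 0" if "j \<in> {- int B, int B + 1}" for j
  proof -
    have "N - K * j < 0 \<or> int m < N - K * j"
    proof (cases "j = - int B")
      case True
      then have "K * j = - (K * int B)" by simp
      then show ?thesis using assms B by linarith
    next
      case False
      then have "K * j = K * int B + K" using that by (simp add: distrib_left)
      then show ?thesis using assms B i by linarith
    qed
    then show ?thesis by (simp add: qbinom_eq_0)
  qed
  have "sum ?g {- int B..int B} = sum ?g {1 - int B..int B}"
    by (intro sum.mono_neutral_right ballI 1) auto
  also have "\<dots> = sum ?g {1 - int B..int B + 1}"
    by (intro sum.mono_neutral_left ballI 1) auto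
  also have "\<dots> = (\<Sum>j\<in>{- int B..int B}. qpow ((K * j - i) * (2 * j - 2)) * qbinom (int m) (N - K * j + i))"
  proof (rule sum.reindex_bij_witness[of _ "\<lambda>j. 1 - j" "\<lambda>j. 1 - j"])
    fix j :: int
    have "int m - (N - K * (1 - j) + i) = N - K * j" using assms by (simp add: algebra_simps)
    then show "qpow ((K * (1 - j) - i) * (2 * (1 - j) - 2)) * qbinom (int m) (N - K * (1 - j) + i) = ?g j"
      using qbinom_symmetric[of "int m" "N - K * (1 - j) + i"] by (simp add: algebra_simps)
  qed auto
  finally show ?thesis by (simp add: hook_poly_def sum_subtractf)
qed

text \<open>Trading \<open>\<beta>\<close> against \<open>2 - \<beta>\<close> keeps the recurrences inside the three families
  \<open>\<beta> = 0, 1, 2\<close>; the step that would leave the strip starts at a point where the sum vanishes.\<close>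

lemma nonneg_hook_poly:
  assumes "2 < K" "m < B" "0 \<le> \<beta>" "\<beta> \<le> 2"
    and "\<beta> - i \<le> 2 * N - int m" "2 * N - int m \<le> K - 2 + \<beta> - i"
  shows "nonneg_poly (hook_poly B K i \<beta> m N)"
  using assms
proof (induction m arbitrary: \<beta> N)
  case 0
  show ?case
  proof (cases "N = 0")
    case True
    \<comment> \<open>No multiple of \<open>K\<close> equals \<open>i\<close>, so the negative terms
      all vanish.\<close>
    have "qbinom 0 (i - K * j) = 0" for j
    proof -
      have "i - K * j < 0 \<or> 0 < i - K * j"
        using mult_K_bounds(1,2)[of j] i by linarith
      then show ?thesis by (auto simp: qbinom_eq_0)
    qed
    then have "hook_poly B K i \<beta> 0 N = (\<Sum>j\<in>{- int B..int B}.
        qpow (j * (2 * K * j + 2 * i - K * \<beta>)) * qbinom (int 0) (N - K * j))"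
      by (simp add: hook_poly_def True algebra_simps)
    then show ?thesis
      by (simp del: of_nat_0 add: nonneg_poly_sum nonneg_poly_mult)
  next
    case False
    then show ?thesis
      using hook_poly_eq_0_outside[of \<beta> N 0 B] 0 by (simp add: neq_iff)
  qed
next
  case (Suc m)
  show ?case
  proof (cases "N < 0 \<or> int (Suc m) < N")
    case True
    then show ?thesis using hook_poly_eq_0_outside[of \<beta> N "Suc m" B] Suc.prems by simp
  next
    case N: False
    \<comment> \<open>The term keeping \<open>\<beta>\<close> moves by one towards an edge, so each
      recurrence needs a strict bound on that side. For \<open>\<beta> = 1\<close> one of them
      always applies, since \<open>2 < K\<close> separates the edges; for
      \<open>\<beta> = 0, 2\<close> the bad edge is a zero.\<close>
    consider "\<beta> = 0 \<and> 2 * N - int (Suc m) = - i" | "\<beta> = 2 \<and> 2 * N - int (Suc m) = K - i"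
      | "\<beta> \<le> 1" "\<beta> - i < 2 * N - int (Suc m)"
      | "1 \<le> \<beta>" "2 * N - int (Suc m) < K - 2 + \<beta> - i"
      using Suc.prems i by linarith
    then show ?thesis
    proof cases
      case 1
      then show ?thesis by (simp add: hook_poly_eq_0_lower)
    next
      case 2
      then show ?thesis using N Suc.prems by (simp add: hook_poly_eq_0_upper)
    next
      case 3
      then show ?thesis
        using N Suc.prems
        by (subst hook_poly_rec1; (intro nonneg_poly_add nonneg_poly_mult Suc.IH nonneg_poly_qpow)?; simp)
    next
      case 4
      then show ?thesis
        using N Suc.prems
        by (subst hook_poly_rec2; (intro nonneg_poly_add nonneg_poly_mult Suc.IH nonneg_poly_qpow)?; simp)
    qed
  qed
qed

end

section \<open>Expansions of Gaussian binomials\<close>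

text \<open>Zero for the wrong parity, so that sums over all \<open>k\<close> encode those over
  \<open>k \<equiv> a (mod 2)\<close>.\<close>

definition aligned :: "nat \<Rightarrow> int \<Rightarrow> rat poly" where
  "aligned k a = (if even (int k - a) then qbinom (int k) ((int k - a) div 2) else 0)"

lemma aligned_uminus: "aligned k (- a) = aligned k a"
proof (cases "even (int k - a)")
  case True
  then have "int k - (int k - a) div 2 = (int k + a) div 2" by presburger
  with True show ?thesis
    using qbinom_symmetric[of "int k" "(int k - a) div 2"] by (simp add: aligned_def)
qed (simp add: aligned_def)

lemma aligned_add_double: "aligned (c + 2 * v) (int c) = gauss (c + 2 * v) v"
  using qbinom_nat[of "c + 2 * v" v] by (simp add: aligned_def)

lemma qbinom_half_eq_aligned:
  "qbinom (int k) ((int k - a) div 2) = aligned k a + aligned k (a + 1)"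
proof (cases "even (int k - a)")
  case False
  then have "(int k - a) div 2 = (int k - (a + 1)) div 2" by (auto elim!: oddE)
  with False show ?thesis by (simp add: aligned_def)
qed (simp add: aligned_def)

text \<open>For \<open>k + m \<le> L\<close> the Gaussian product is the
  \<open>q\<close>-multinomial with parts \<open>k\<close>, \<open>m\<close>,
  \<open>L - k - m\<close>.\<close>

definition coef :: "nat \<Rightarrow> nat \<Rightarrow> nat \<Rightarrow> rat poly" where
  "coef L k m = q ^ (m\<^sup>2 + m * k + k\<^sup>2 div 2) * (gauss L k * gauss (L - k) m)"

lemma coef_eq_0: "L < k + m \<Longrightarrow> coef L k m = 0"
  by (cases "L < k") (simp_all add: coef_def gauss_eq_0)

lemma nonneg_poly_coef [simp]: "nonneg_poly (coef L k m)"
  by (simp add: coef_def nonneg_poly_mult)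

text \<open>Regrouping by \<open>gauss_trinomial\<close> with parts \<open>m\<close>,
  \<open>v + c\<close>, \<open>v\<close>, \<open>w\<close>. For fixed \<open>b = m + v\<close> the
  last factor becomes a Vandermonde summand in \<open>m\<close>.\<close>

lemma coef_mult_gauss:
  "coef L (c + 2 * v) m * gauss (c + 2 * v) v
    = q ^ ((m + v) * (m + v + c) + c\<^sup>2 div 2) * gauss L (m + v + c)
      * (q ^ ((v + c) * v) * (gauss (m + v + c) m * gauss (L - (m + v + c)) v))"
proof (cases "m + (v + c) + v \<le> L")
  case True
  then obtain w where L: "L = m + (v + c) + v + w" using le_Suc_ex by blast
  \<comment> \<open>The squares differ by an even number, so their halves rounded down differ by
    exactly half of it.\<close>
  have "(c + 2 * v)\<^sup>2 = c\<^sup>2 + 2 * (2 * c * v + 2 * v\<^sup>2)"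
    by (simp add: power2_eq_square algebra_simps)
  then have "(c + 2 * v)\<^sup>2 div 2 = c\<^sup>2 div 2 + (2 * c * v + 2 * v\<^sup>2)"
    by simp
  then have e: "m\<^sup>2 + m * (c + 2 * v) + (c + 2 * v)\<^sup>2 div 2
      = ((m + v) * (m + v + c) + c\<^sup>2 div 2) + (v + c) * v"
    by (simp add: power2_eq_square algebra_simps)
  have c: "v + c + v = c + 2 * v" "m + (v + c) = m + v + c" by simp_all
  have "L - (c + 2 * v) = m + w" "L - (m + v + c) = v + w" using L by simp_all
  with gauss_trinomial[of m "v + c" v w, folded L]
  have g: "gauss L (c + 2 * v) * (gauss (L - (c + 2 * v)) m * gauss (c + 2 * v) v)
      = gauss L (m + v + c) * (gauss (m + v + c) m * gauss (L - (m + v + c)) v)"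
    unfolding c by simp
  have "coef L (c + 2 * v) m * gauss (c + 2 * v) v
      = q ^ (m\<^sup>2 + m * (c + 2 * v) + (c + 2 * v)\<^sup>2 div 2)
        * (gauss L (c + 2 * v) * (gauss (L - (c + 2 * v)) m * gauss (c + 2 * v) v))"
    by (simp only: coef_def mult.assoc)
  also have "\<dots> = q ^ ((m + v) * (m + v + c) + c\<^sup>2 div 2) * gauss L (m + v + c)
      * (q ^ ((v + c) * v) * (gauss (m + v + c) m * gauss (L - (m + v + c)) v))"
    unfolding e g power_add[of q _ "(v + c) * v"] by (simp only: ac_simps)
  finally show ?thesis .
next
  case False
  then have "gauss L (m + v + c) = 0 \<or> gauss (L - (m + v + c)) v = 0"
    by (cases "L < m + v + c") (simp_all add: gauss_eq_0)
  with False show ?thesis by (auto simp: coef_eq_0)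
qed

text \<open>Iterated \<open>q\<close>-Vandermonde: expanding both binomials of the right-hand side along the size
  \<open>m\<close> of a common part leaves \<open>k = c + 2 v\<close> elements outside it.\<close>

lemma aligned_expansion:
  "(\<Sum>k\<le>L. \<Sum>m\<le>L. \<phi> (k + 2 * m) * coef L k m * aligned k (int c))
    = (\<Sum>b\<le>L. \<phi> (2 * b + c) * q ^ (b * (b + c) + c\<^sup>2 div 2) * (gauss L (b + c) * gauss L b))"
    (is "?lhs = ?rhs")
proof -
  define F where "F k = (\<Sum>m\<le>L. \<phi> (k + 2 * m) * coef L k m * aligned k (int c))" for k
  \<comment> \<open>With \<open>k = c + 2 * v\<close> the argument of \<open>\<phi>\<close> depends
    only on \<open>m + v\<close>, so the weight is constant on each inner sum.\<close>
  define G where "G m v = \<phi> (2 * (m + v) + c) * (coef L (c + 2 * v) m * gauss (c + 2 * v) v)" for m v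
  have FG: "F (c + 2 * v) = (\<Sum>m\<le>L. G m v)" for v
    unfolding F_def G_def aligned_add_double by (simp add: algebra_simps)
  have G0: "m + v \<le> L" if "G m v \<noteq> 0" for m v
    using that by (cases "m + v \<le> L") (simp_all add: G_def coef_eq_0)
  have "?lhs = sum F {..L}" by (simp add: F_def)
  \<comment> \<open>Other \<open>k\<close> have the wrong parity or are below \<open>c\<close>;
    image points above \<open>L\<close> contribute zero through \<open>coef\<close>.\<close>
  also have "\<dots> = sum F ((\<lambda>v. c + 2 * v) ` {..L})"
  proof (rule sum.mono_neutral_cong)
    fix k assume k: "k \<in> {..L} - (\<lambda>v. c + 2 * v) ` {..L}"
    have "odd (int k - int c) \<or> k < c"
    proof (rule ccontr)
      assume "\<not> (odd (int k - int c) \<or> k < c)"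
      then have "k = c + 2 * ((k - c) div 2)" "(k - c) div 2 \<le> L" using k by auto
      with k show False by blast
    qed
    then have "aligned k (int c) = 0"
      by (elim disjE) (simp_all add: aligned_def qbinom_eq_0)
    then show "F k = 0" by (simp add: F_def)
  qed (auto simp: F_def coef_eq_0)
  also have "\<dots> = (\<Sum>v\<le>L. \<Sum>m\<le>L. G m v)"
    by (subst sum.reindex) (auto simp: inj_on_def FG)
  also have "\<dots> = (\<Sum>(m, v)\<in>{..L} \<times> {..L}. G m v)"
    by (subst sum.swap) (simp add: sum.cartesian_product)
  also have "\<dots> = (\<Sum>(m, v)\<in>{(m, v). m + v \<le> L}. G m v)"
    by (rule sum.mono_neutral_right) (auto dest: G0)
  also have "\<dots> = (\<Sum>b\<le>L. \<Sum>m\<le>b. G m (b - m))"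
    by (rule sum.triangle_reindex_eq)
  also have "\<dots> = ?rhs"
  proof (rule sum.cong[OF refl])
    fix b assume "b \<in> {..L}"
    let ?C = "q ^ (b * (b + c) + c\<^sup>2 div 2) * gauss L (b + c)"
    have "(\<Sum>m\<le>b. G m (b - m)) = (\<Sum>m\<le>b. \<phi> (2 * b + c) * ?C *
        (q ^ ((b + c - m) * (b - m)) * (gauss (b + c) m * gauss (L - (b + c)) (b - m))))"
      by (rule sum.cong[OF refl]) (simp add: G_def coef_mult_gauss mult.assoc)
    also have "\<dots> = \<phi> (2 * b + c) * ?C * gauss (b + c + (L - (b + c))) b"
      by (simp only: gauss_Vandermonde sum_distrib_left)
    also have "\<dots> = \<phi> (2 * b + c) * q ^ (b * (b + c) + c\<^sup>2 div 2) * (gauss L (b + c) * gauss L b)"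
      by (cases "b + c \<le> L") (simp_all add: gauss_eq_0 mult.assoc)
    finally show "(\<Sum>m\<le>b. G m (b - m))
      = \<phi> (2 * b + c) * q ^ (b * (b + c) + c\<^sup>2 div 2) * (gauss L (b + c) * gauss L b)" .
  qed
  finally show ?thesis .
qed

text \<open>The case \<open>\<phi> = 1\<close>; \<open>gauss_Vandermonde'\<close> sums the
  right-hand side, and negative \<open>a\<close> follow by symmetry.\<close>

lemma qbinom_even_expansion:
  "qpow (a\<^sup>2 div 2) * qbinom (2 * int L) (int L - a) = (\<Sum>k\<le>L. \<Sum>m\<le>L. coef L k m * aligned k a)"
proof -
  have *: "qpow ((int c)\<^sup>2 div 2) * qbinom (2 * int L) (int L - int c)
      = (\<Sum>k\<le>L. \<Sum>m\<le>L. coef L k m * aligned k (int c))" for c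
  proof -
    have "(\<Sum>k\<le>L. \<Sum>m\<le>L. coef L k m * aligned k (int c))
        = q ^ (c\<^sup>2 div 2) * (\<Sum>b\<le>L. q ^ (b * (b + c)) * (gauss L (b + c) * gauss L b))"
      using aligned_expansion[of "\<lambda>_. 1" L c] by (simp add: sum_distrib_left power_add ac_simps)
    also have "\<dots> = qpow ((int c)\<^sup>2 div 2) * qbinom (2 * int L) (int L - int c)"
    proof (cases "c \<le> L")
      case True
      then have 1: "int L - int c = int (L - c)" "2 * int L = int (L + L)" by simp_all
      have 2: "qpow ((int c)\<^sup>2 div 2) = q ^ (c\<^sup>2 div 2)"
        by (simp add: qpow_def nat_div_distrib nat_power_eq)
      show ?thesis
        unfolding 1 2 qbinom_nat gauss_Vandermonde'[OF True order.refl] ..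
    qed (simp add: gauss_eq_0 qbinom_eq_0)
    finally show ?thesis by simp
  qed
  show ?thesis
  proof (cases "0 \<le> a")
    case True
    then show ?thesis using *[of "nat a"] by simp
  next
    case False
    have "2 * int L - (int L - a) = int L + a" by simp
    then have "qbinom (2 * int L) (int L - a) = qbinom (2 * int L) (int L + a)"
      by (metis qbinom_symmetric)
    then show ?thesis using *[of "nat (- a)"] False by (simp add: aligned_uminus)
  qed
qed

text \<open>The rounded binomial splits into its aligned parts at \<open>a\<close> and
  \<open>a + 1\<close>. The weight \<open>\<phi> x = q ^ ((x + 1) div 2)\<close> makes the two
  resulting sums fit together by Pascal's rule, raising one \<open>L\<close> to
  \<open>Suc L\<close>.\<close>

lemma qbinom_odd_expansion:
  "qpow (a * (a + 1) div 2) * qbinom (2 * int L + 1) (int L - a)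
    = (\<Sum>k\<le>L. \<Sum>m\<le>L. q ^ ((k + 2 * m + 1) div 2) * coef L k m * qbinom (int k) ((int k - a) div 2))"
proof -
  have *: "qpow (int c * (int c + 1) div 2) * qbinom (2 * int L + 1) (int L - int c)
      = (\<Sum>k\<le>L. \<Sum>m\<le>L. q ^ ((k + 2 * m + 1) div 2) * coef L k m * qbinom (int k) ((int k - int c) div 2))" for c
  proof -
    let ?W = "\<lambda>c. \<Sum>k\<le>L. \<Sum>m\<le>L. q ^ ((k + 2 * m + 1) div 2) * coef L k m * aligned k (int c)"
    have T: "(2 * b + d + 1) div 2 + (b * (b + d) + d\<^sup>2 div 2) = b * (b + d + 1) + d * (d + 1) div 2"
      for b d :: nat
    proof -
      have "(2 * b + d + 1) div 2 + d\<^sup>2 div 2 = b + d * (d + 1) div 2"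
        by (cases "even d") (auto elim!: evenE oddE simp: power2_eq_square algebra_simps)
      then show ?thesis by (simp add: algebra_simps)
    qed
    have W: "?W d = (\<Sum>b\<le>L. q ^ (b * (b + d + 1) + d * (d + 1) div 2) * (gauss L (b + d) * gauss L b))" for d
      unfolding aligned_expansion[of "\<lambda>x. q ^ ((x + 1) div 2)" L d] power_add[symmetric] T ..
    have "(\<Sum>k\<le>L. \<Sum>m\<le>L. q ^ ((k + 2 * m + 1) div 2) * coef L k m * qbinom (int k) ((int k - int c) div 2))
        = ?W c + ?W (Suc c)"
      unfolding qbinom_half_eq_aligned distrib_left sum.distrib by (simp add: add.commute)
    also have "\<dots> = (\<Sum>b\<le>L. q ^ (c * (c + 1) div 2) *
        (q ^ (b * (b + Suc c)) * (gauss (Suc L) (b + Suc c) * gauss L b)))"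
    proof -
      \<comment> \<open>This increment leaves precisely the factor \<open>q ^ Suc (b + c)\<close> of
        Pascal's rule between the two sums.\<close>
      have "Suc c * (Suc c + 1) div 2 = c * (c + 1) div 2 + Suc c"
        by (cases "even c") (auto elim!: evenE oddE simp: algebra_simps)
      then have e: "b * (b + c + 1) + c * (c + 1) div 2 = c * (c + 1) div 2 + b * (b + Suc c)"
        "b * (b + Suc c + 1) + Suc c * (Suc c + 1) div 2
          = c * (c + 1) div 2 + b * (b + Suc c) + Suc (b + c)" for b
        by (simp_all add: algebra_simps)
      show ?thesis
        unfolding W sum.distrib[symmetric]
      proof (rule sum.cong[OF refl])
        fix b
        show "q ^ (b * (b + c + 1) + c * (c + 1) div 2) * (gauss L (b + c) * gauss L b)
            + q ^ (b * (b + Suc c + 1) + Suc c * (Suc c + 1) div 2) * (gauss L (b + Suc c) * gauss L b)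
          = q ^ (c * (c + 1) div 2) * (q ^ (b * (b + Suc c)) * (gauss (Suc L) (b + Suc c) * gauss L b))"
          unfolding e unfolding power_add[of q "_ + _"] power_add[of q "c * (c + 1) div 2"]
          unfolding add_Suc_right gauss.simps
          by (simp only: distrib_left distrib_right mult.assoc)
      qed
    qed
    also have "\<dots> = qpow (int c * (int c + 1) div 2) * qbinom (2 * int L + 1) (int L - int c)"
    proof (cases "c \<le> L")
      case True
      then have 1: "int L - int c = int (Suc L - Suc c)" "2 * int L + 1 = int (Suc L + L)" by simp_all
      have 2: "qpow (int c * (int c + 1) div 2) = q ^ (c * (c + 1) div 2)"
        by (simp add: qpow_def nat_div_distrib nat_mult_distrib nat_add_distrib)
      show ?thesis
        unfolding 1 2 qbinom_nat sum_distrib_left[symmetric]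
        using True by (subst gauss_Vandermonde') simp_all
    qed (simp add: gauss_eq_0 qbinom_eq_0)
    finally show ?thesis by simp
  qed
  show ?thesis
  proof (cases "0 \<le> a")
    case True
    then show ?thesis using *[of "nat a"] by simp
  next
    case False
    \<comment> \<open>The reflection \<open>a \<mapsto> - a - 1\<close> fixes
      \<open>a * (a + 1)\<close> and the left binomial and swaps the two aligned parts on the
      right.\<close>
    define c where "c = nat (- a - 1)"
    have a: "a = - int c - 1" using False by (simp add: c_def)
    have "2 * int L + 1 - (int L - a) = int L - int c" using a by simp
    then have 1: "qbinom (2 * int L + 1) (int L - a) = qbinom (2 * int L + 1) (int L - int c)"
      by (metis qbinom_symmetric)
    have 2: "qbinom (int k) ((int k - a) div 2) = qbinom (int k) ((int k - int c) div 2)" for k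
    proof -
      have "a = - (int c + 1)" "a + 1 = - int c" by (simp_all add: a)
      then show ?thesis
        unfolding qbinom_half_eq_aligned by (simp only: aligned_uminus add.commute)
    qed
    have 3: "a * (a + 1) = int c * (int c + 1)" by (simp add: a algebra_simps)
    show ?thesis unfolding 1 2 3 by (rule *)
  qed
qed

section \<open>Positivity-preserving transformations\<close>

text \<open>Since \<open>c k m\<close> is independent of \<open>j\<close>, the signed sum over
  \<open>j\<close> can be moved innermost.\<close>

lemma nonneg_poly_weighted_sum:
  assumes "\<And>k m. k \<le> L \<Longrightarrow> nonneg_poly (\<Sum>j\<in>J. w j * f k m j)"
    and "\<And>k m. nonneg_poly (c k m)"
    and "\<And>j. j \<in> J \<Longrightarrow> g j = (\<Sum>k\<le>L. \<Sum>m\<le>L. c k m * f k m j)"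
  shows "nonneg_poly (\<Sum>j\<in>J. w j * g j)"
proof -
  have "(\<Sum>j\<in>J. w j * g j) = (\<Sum>j\<in>J. \<Sum>k\<le>L. \<Sum>m\<le>L. c k m * (w j * f k m j))"
    by (rule sum.cong[OF refl]) (simp add: assms(3) sum_distrib_left mult.left_commute)
  also have "\<dots> = (\<Sum>k\<le>L. \<Sum>m\<le>L. c k m * (\<Sum>j\<in>J. w j * f k m j))"
    by (subst sum.swap, rule sum.cong[OF refl], subst sum.swap) (simp add: sum_distrib_left)
  also have "nonneg_poly \<dots>"
    by (intro nonneg_poly_sum nonneg_poly_mult assms) auto
  finally show ?thesis .
qed

lemma odd_transform_nonneg:
  assumes "\<And>k. k \<le> L \<Longrightarrow> nonneg_poly (\<Sum>j\<in>J. w j * qbinom (int k) ((int k - b j) div 2))"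
  shows "nonneg_poly (\<Sum>j\<in>J. w j * (qpow (b j * (b j + 1) div 2) * qbinom (2 * int L + 1) (int L - b j)))"
  by (rule nonneg_poly_weighted_sum[where L = L, OF _ _ qbinom_odd_expansion])
    (auto intro!: assms nonneg_poly_mult)

text \<open>When all \<open>a j\<close> share a parity, only \<open>k\<close> of that parity
  contribute, and for these \<open>aligned\<close> is the plain binomial.\<close>

lemma even_transform_nonneg:
  assumes "\<And>j. j \<in> J \<Longrightarrow> a j mod 2 = int p"
    and "\<And>k. k \<le> L \<Longrightarrow> int k mod 2 = int p
      \<Longrightarrow> nonneg_poly (\<Sum>j\<in>J. w j * qbinom (int k) ((int k - a j) div 2))"
  shows "nonneg_poly (\<Sum>j\<in>J. w j * (qpow ((a j)\<^sup>2 div 2) * qbinom (2 * int L) (int L - a j)))"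
proof (rule nonneg_poly_weighted_sum[where L = L, OF _ _ qbinom_even_expansion])
  fix k m assume k: "k \<le> L"
  show "nonneg_poly (\<Sum>j\<in>J. w j * aligned k (a j))"
  proof (cases "int k mod 2 = int p")
    case True
    then have "even (int k - a j)" if "j \<in> J" for j
      using assms(1)[OF that] by presburger
    then have "(\<Sum>j\<in>J. w j * aligned k (a j)) = (\<Sum>j\<in>J. w j * qbinom (int k) ((int k - a j) div 2))"
      by (intro sum.cong) (simp_all only: aligned_def if_True)
    with assms(2)[OF k True] show ?thesis by simp
  next
    case False
    then have "odd (int k - a j)" if "j \<in> J" for j
      using assms(1)[OF that] by presburger
    then have "(\<Sum>j\<in>J. w j * aligned k (a j)) = 0"
      by (intro sum.neutral ballI) (simp only: aligned_def if_False mult_zero_right)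
    then show ?thesis by simp
  qed
qed simp

text \<open>Pairing \<open>2 * j\<close> with \<open>1 - 2 * j\<close> produces the positive and
  negative terms of \<open>hook_poly\<close> over the same cut-off.\<close>

lemma sum_even_odd_split:
  fixes f :: "int \<Rightarrow> 'a :: comm_monoid_add"
  shows "(\<Sum>j\<in>{- 2 * int B..2 * int B + 1}. f j) = (\<Sum>j\<in>{- int B..int B}. f (2 * j) + f (1 - 2 * j))"
proof -
  have "{- 2 * int B..2 * int B + 1}
      = (\<lambda>j. 2 * j) ` {- int B..int B} \<union> (\<lambda>j. 1 - 2 * j) ` {- int B..int B}" (is "?L = ?R")
  proof
    show "?L \<subseteq> ?R"
    proof
      fix x assume x: "x \<in> ?L"
      show "x \<in> ?R"
      proof (cases "even x")
        case True
        then have "x = 2 * (x div 2)" "x div 2 \<in> {- int B..int B}" using x by auto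
        then show ?thesis by blast
      next
        case False
        then have "x = 1 - 2 * ((1 - x) div 2)" "(1 - x) div 2 \<in> {- int B..int B}"
          using x by (auto elim!: oddE)
        then show ?thesis by blast
      qed
    qed
  qed auto
  moreover have "(\<lambda>j. 2 * j) ` {- int B..int B} \<inter> (\<lambda>j. 1 - 2 * j) ` {- int B..int B} = {}"
    by (auto, presburger)
  ultimately show ?thesis
    by (simp add: sum.union_disjoint sum.reindex inj_on_def sum.distrib)
qed

lemma neg_one_power_even_odd: "(- 1 :: rat poly) ^ nat \<bar>2 * j\<bar> = 1" "(- 1 :: rat poly) ^ nat \<bar>1 - 2 * j\<bar> = -1"
  by (simp_all add: uminus_power_if even_nat_iff)

text \<open>Even indices give the first sum of \<open>hook_poly\<close> with
  \<open>i = \<nu> + s + 1\<close>, \<open>\<beta> = 1\<close>; odd ones, after reflecting the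
  binomial, give the second.\<close>

lemma Foda_Quano_nonneg:
  fixes \<nu> s :: nat
  assumes "s < \<nu>" "k < B"
  defines "K \<equiv> 2 * int \<nu> + 1"
  shows "nonneg_poly (\<Sum>j\<in>{- 2 * int B..2 * int B + 1}.
    (- 1) ^ nat \<bar>j\<bar> * qpow (j * (K * j + 2 * int s + 1) div 2)
      * qbinom (int k) ((int k - (K * j + int s)) div 2))"
proof -
  define N where "N = (int k - int s) div 2"
  let ?i = "int \<nu> + int s + 1"
  have "(\<Sum>j\<in>{- 2 * int B..2 * int B + 1}.
    (- 1) ^ nat \<bar>j\<bar> * qpow (j * (K * j + 2 * int s + 1) div 2)
      * qbinom (int k) ((int k - (K * j + int s)) div 2)) = hook_poly B K ?i 1 k N"
    unfolding sum_even_odd_split hook_poly_def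
  proof (rule sum.cong[OF refl])
    fix j
    have 1: "2 * j * (K * (2 * j) + 2 * int s + 1) div 2 = j * (2 * K * j + 2 * ?i - K * 1)"
      by (simp add: K_def algebra_simps)
    have "(1 - 2 * j) * (K * (1 - 2 * j) + 2 * int s + 1) = 2 * ((K * j - ?i) * (2 * j - 1))"
      by (simp add: K_def algebra_simps)
    then have 2: "(1 - 2 * j) * (K * (1 - 2 * j) + 2 * int s + 1) div 2 = (K * j - ?i) * (2 * j - 1)"
      by simp
    have "(int k - (K * (2 * j) + int s)) = (int k - int s) + 2 * (- K * j)" by simp
    then have 3: "(int k - (K * (2 * j) + int s)) div 2 = N - K * j"
      by (simp add: N_def)
    have "int k - (K * (1 - 2 * j) + int s) = (int k - int s - 1) + 2 * (K * j - int \<nu>)"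
      by (simp add: K_def algebra_simps)
    then have "(int k - (K * (1 - 2 * j) + int s)) div 2 = (int k - int s - 1) div 2 + (K * j - int \<nu>)"
      by simp
    then have 4: "int k - (int k - (K * (1 - 2 * j) + int s)) div 2 = N - K * j + ?i"
      unfolding N_def by presburger
    show "(- 1) ^ nat \<bar>2 * j\<bar> * qpow (2 * j * (K * (2 * j) + 2 * int s + 1) div 2) *
          qbinom (int k) ((int k - (K * (2 * j) + int s)) div 2) +
          (- 1) ^ nat \<bar>1 - 2 * j\<bar> * qpow ((1 - 2 * j) * (K * (1 - 2 * j) + 2 * int s + 1) div 2) *
          qbinom (int k) ((int k - (K * (1 - 2 * j) + int s)) div 2)
        = qpow (j * (2 * K * j + 2 * ?i - K * 1)) * qbinom (int k) (N - K * j)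
          - qpow ((K * j - ?i) * (2 * j - 1)) * qbinom (int k) (N - K * j + ?i)"
      unfolding 1 2 3 neg_one_power_even_odd 4[symmetric] qbinom_symmetric by simp
  qed
  \<comment> \<open>Here \<open>2 * N - k\<close> is \<open>- s\<close> or \<open>- s - 1\<close>,
    inside the strip because \<open>\<nu> \<ge> 1\<close>.\<close>
  moreover have "1 - ?i \<le> 2 * N - int k" "2 * N - int k \<le> K - 2 + 1 - ?i"
    using assms(1) by (auto simp: N_def K_def)
  ultimately show ?thesis
    using nonneg_hook_poly[of ?i K k B 1 N] assms by (simp add: K_def)
qed

text \<open>Only odd \<open>k = 2 l + 1\<close> enter the first even step, and
  \<open>(k - (2 b + 1)) / 2 = l - b\<close> matches the output of the odd step; later steps see
  \<open>k = 2 l\<close> and double the offset. Sizes only shrink, so the bound \<open>B\<close>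
  persists.\<close>

lemma iterated_transform_nonneg:
  assumes "\<And>k. k < B \<Longrightarrow> nonneg_poly (\<Sum>j\<in>J. w j * qbinom (int k) ((int k - b j) div 2))"
    and "L < B"
  shows "nonneg_poly (\<Sum>j\<in>J. w j * qpow (b j * (b j + 1) div 2)
      * (\<Prod>t\<le>r. qpow ((2 ^ t * (2 * b j + 1))\<^sup>2 div 2)) * qbinom (2 * int L) (int L - 2 ^ r * (2 * b j + 1)))"
  using assms(2)
proof (induction r arbitrary: L)
  case 0
  have "nonneg_poly (\<Sum>j\<in>J. w j * qpow (b j * (b j + 1) div 2)
      * (qpow ((2 * b j + 1)\<^sup>2 div 2) * qbinom (2 * int L) (int L - (2 * b j + 1))))"
  proof (rule even_transform_nonneg[where p = 1])
    fix k assume k: "k \<le> L" "int k mod 2 = int 1"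
    define l where "l = k div 2"
    have l: "int k = 2 * int l + 1" "l < B"
      using k 0 by (auto simp: l_def) presburger
    have "(2 * int l + 1 - (2 * b j + 1)) div 2 = int l - b j" for j
      by simp
    then show "nonneg_poly (\<Sum>j\<in>J. w j * qpow (b j * (b j + 1) div 2)
        * qbinom (int k) ((int k - (2 * b j + 1)) div 2))"
      using odd_transform_nonneg[where L = l and w = w and b = b and J = J] assms(1) l by (simp add: mult.assoc)
  qed simp
  then show ?case by (simp add: mult.assoc)
next
  case (Suc r)
  let ?w = "\<lambda>j. w j * qpow (b j * (b j + 1) div 2) * (\<Prod>t\<le>r. qpow ((2 ^ t * (2 * b j + 1))\<^sup>2 div 2))"
  have "nonneg_poly (\<Sum>j\<in>J. ?w j * (qpow ((2 ^ Suc r * (2 * b j + 1))\<^sup>2 div 2)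
      * qbinom (2 * int L) (int L - 2 ^ Suc r * (2 * b j + 1))))"
  proof (rule even_transform_nonneg[where p = 0])
    fix k assume k: "k \<le> L" "int k mod 2 = int 0"
    define l where "l = k div 2"
    have l: "k = 2 * l" "l < B"
      using k Suc.prems by (auto simp: l_def)
    have "(int k - 2 ^ Suc r * (2 * b j + 1)) div 2 = int l - 2 ^ r * (2 * b j + 1)" for j
      by (simp add: l(1))
    then show "nonneg_poly (\<Sum>j\<in>J. ?w j * qbinom (int k) ((int k - 2 ^ Suc r * (2 * b j + 1)) div 2))"
      using Suc.IH[OF l(2)] by (simp add: l(1))
  qed simp
  then show ?case by (simp add: mult.assoc)
qed

section \<open>Accumulated exponents and the passage to \<open>G_coeff\<close>\<close>

lemma geometric_sum_4: "3 * (\<Sum>t\<le>r. 4 ^ t) = (4 ^ Suc r - 1 :: 'a :: comm_ring_1)"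
  by (induction r) (simp_all add: algebra_simps)

lemma quadratic_exponent_nonneg:
  assumes "s < \<nu>"
  shows "0 \<le> j * ((2 * int \<nu> + 1) * j + 2 * int s + 1)"
proof (cases "0 \<le> j")
  case False
  then have "(2 * int \<nu> + 1) * j \<le> (2 * int \<nu> + 1) * - 1" by (intro mult_left_mono) simp_all
  then have "(2 * int \<nu> + 1) * j + 2 * int s + 1 \<le> 0" using assms by simp
  then show ?thesis using False by (simp add: mult_nonpos_nonpos)
qed simp

text \<open>Each accumulated exponent is its value at \<open>j = 0\<close> plus a multiple of
  \<open>Y j\<close>: \<open>1 / 2\<close> initially, \<open>K / 2\<close> from the triangular
  number, \<open>2 * K * 4 ^ t\<close> from stage \<open>t\<close>. The first two add up to
  \<open>\<nu> + 1\<close>. The values at \<open>j = 0\<close> form the power \<open>Q\<close>,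
  which is cancelled.\<close>

lemma G_poly_nonneg:
  fixes L \<nu> s r :: nat
  assumes "s < \<nu>"
  defines "K \<equiv> 2 * int \<nu> + 1"
  shows "nonneg_poly (\<Sum>j\<in>{- 2 * int (Suc L)..2 * int (Suc L) + 1}. (- 1) ^ nat \<bar>j\<bar>
    * qpow ((int \<nu> + 1 + 2 * K * (\<Sum>t\<le>r. 4 ^ t)) * (j * (K * j + 2 * int s + 1)))
    * qbinom (2 * int L) (int L - 2 ^ r * (2 * (K * j + int s) + 1)))"
proof -
  define Y where "Y j = j * (K * j + 2 * int s + 1)" for j
  define Q where "Q = qpow (int s * (int s + 1) div 2) * (\<Prod>t\<le>r. qpow ((2 ^ t * (2 * int s + 1))\<^sup>2 div 2))"
  have Y_nonneg: "0 \<le> Y j" for j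
    unfolding Y_def K_def using assms(1) by (rule quadratic_exponent_nonneg)
  have Y_even: "even (Y j)" for j
    by (simp add: Y_def K_def) 
  have weight: "qpow (Y j div 2) * qpow ((K * j + int s) * (K * j + int s + 1) div 2)
      * (\<Prod>t\<le>r. qpow ((2 ^ t * (2 * (K * j + int s) + 1))\<^sup>2 div 2))
      = Q * qpow ((int \<nu> + 1 + 2 * K * (\<Sum>t\<le>r. 4 ^ t)) * Y j)" for j
  proof -
    have KY: "0 \<le> K * Y j" using Y_nonneg by (simp add: K_def)
    have T: "0 \<le> int s * (int s + 1) div 2" by simp
    obtain y where y: "Y j = 2 * y" using Y_even by blast
    have "(K * j + int s) * (K * j + int s + 1) = int s * (int s + 1) + K * Y j"
      by (simp add: Y_def algebra_simps)
    then have "(K * j + int s) * (K * j + int s + 1) div 2 = int s * (int s + 1) div 2 + K * y"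
      by (simp add: y)
    then have "Y j div 2 + (K * j + int s) * (K * j + int s + 1) div 2
        = int s * (int s + 1) div 2 + (int \<nu> + 1) * Y j"
      by (simp add: y K_def algebra_simps)
    moreover have "0 \<le> (K * j + int s) * (K * j + int s + 1) div 2"
      using KY \<open>(K * j + int s) * (K * j + int s + 1) = int s * (int s + 1) + K * Y j\<close> by simp
    ultimately have 1: "qpow (Y j div 2) * qpow ((K * j + int s) * (K * j + int s + 1) div 2)
        = qpow (int s * (int s + 1) div 2) * qpow ((int \<nu> + 1) * Y j)"
      using Y_nonneg[of j] T by (simp flip: qpow_add)
    have 2: "qpow ((2 ^ t * (2 * (K * j + int s) + 1))\<^sup>2 div 2)
        = qpow ((2 ^ t * (2 * int s + 1))\<^sup>2 div 2) * qpow (2 * (K * Y j) * 4 ^ t)" for t :: nat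
    proof -
      have "((2 :: int) ^ t)\<^sup>2 = 4 ^ t" by (simp add: power2_eq_square flip: power_mult_distrib)
      then have "(2 ^ t * (2 * (K * j + int s) + 1))\<^sup>2
          = (2 ^ t * (2 * int s + 1))\<^sup>2 + 2 * (2 * (K * Y j) * 4 ^ t)"
        unfolding power_mult_distrib by (simp add: Y_def power2_eq_square algebra_simps)
      then have "(2 ^ t * (2 * (K * j + int s) + 1))\<^sup>2 div 2
          = (2 ^ t * (2 * int s + 1))\<^sup>2 div 2 + 2 * (K * Y j) * 4 ^ t"
        by simp
      then show ?thesis using KY by (simp add: qpow_add)
    qed
    have 3: "(\<Prod>t\<le>r. qpow (2 * (K * Y j) * 4 ^ t)) = qpow (2 * (K * Y j) * (\<Sum>t\<le>r. 4 ^ t))"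
    proof (induction r)
      case (Suc r)
      have "0 \<le> (\<Sum>t\<le>r. (4 :: int) ^ t)" by (simp add: sum_nonneg)
      then have "0 \<le> 2 * (K * Y j) * (\<Sum>t\<le>r. 4 ^ t)" "0 \<le> 2 * (K * Y j) * 4 ^ Suc r"
        using Y_nonneg by (simp_all add: K_def)
      then show ?case by (simp only: prod.atMost_Suc sum.atMost_Suc distrib_left qpow_add Suc.IH)
    qed simp
    have 4: "qpow ((int \<nu> + 1 + 2 * K * (\<Sum>t\<le>r. 4 ^ t)) * Y j)
        = qpow ((int \<nu> + 1) * Y j) * qpow (2 * (K * Y j) * (\<Sum>t\<le>r. 4 ^ t))"
    proof -
      have "0 \<le> (\<Sum>t\<le>r. (4 :: int) ^ t)" by (simp add: sum_nonneg)
      then have "0 \<le> 2 * (K * Y j) * (\<Sum>t\<le>r. 4 ^ t)" "0 \<le> (int \<nu> + 1) * Y j"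
        using Y_nonneg by (simp_all add: K_def)
      moreover have "(int \<nu> + 1 + 2 * K * S) * Y j = (int \<nu> + 1) * Y j + 2 * (K * Y j) * S" for S
        by (simp add: algebra_simps)
      ultimately show ?thesis by (simp only: qpow_add)
    qed
    show ?thesis
      unfolding 1 2 prod.distrib 3 4 Q_def by (simp only: ac_simps)
  qed
  let ?J = "{- 2 * int (Suc L)..2 * int (Suc L) + 1}"
  have "nonneg_poly (\<Sum>j\<in>?J. (- 1) ^ nat \<bar>j\<bar> * qpow (Y j div 2)
      * qpow ((K * j + int s) * (K * j + int s + 1) div 2)
      * (\<Prod>t\<le>r. qpow ((2 ^ t * (2 * (K * j + int s) + 1))\<^sup>2 div 2))
      * qbinom (2 * int L) (int L - 2 ^ r * (2 * (K * j + int s) + 1)))"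
    using Foda_Quano_nonneg[OF assms(1), of _ "Suc L"]
    by (intro iterated_transform_nonneg[of "Suc L"]) (simp_all add: Y_def K_def)
  also have "(\<Sum>j\<in>?J. (- 1) ^ nat \<bar>j\<bar> * qpow (Y j div 2)
      * qpow ((K * j + int s) * (K * j + int s + 1) div 2)
      * (\<Prod>t\<le>r. qpow ((2 ^ t * (2 * (K * j + int s) + 1))\<^sup>2 div 2))
      * qbinom (2 * int L) (int L - 2 ^ r * (2 * (K * j + int s) + 1)))
    = Q * (\<Sum>j\<in>?J. (- 1) ^ nat \<bar>j\<bar> * qpow ((int \<nu> + 1 + 2 * K * (\<Sum>t\<le>r. 4 ^ t)) * Y j)
      * qbinom (2 * int L) (int L - 2 ^ r * (2 * (K * j + int s) + 1)))"
    unfolding sum_distrib_left[of Q]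
  proof (rule sum.cong[OF refl])
    fix j
    show "(- 1) ^ nat \<bar>j\<bar> * qpow (Y j div 2)
      * qpow ((K * j + int s) * (K * j + int s + 1) div 2)
      * (\<Prod>t\<le>r. qpow ((2 ^ t * (2 * (K * j + int s) + 1))\<^sup>2 div 2))
      * qbinom (2 * int L) (int L - 2 ^ r * (2 * (K * j + int s) + 1))
     = Q * ((- 1) ^ nat \<bar>j\<bar> * qpow ((int \<nu> + 1 + 2 * K * (\<Sum>t\<le>r. 4 ^ t)) * Y j)
      * qbinom (2 * int L) (int L - 2 ^ r * (2 * (K * j + int s) + 1)))"
      using arg_cong[OF weight[of j], of "\<lambda>x. (- 1) ^ nat \<bar>j\<bar> * x
        * qbinom (2 * int L) (int L - 2 ^ r * (2 * (K * j + int s) + 1))"]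
      by (simp only: ac_simps)
  qed
  also have "Q = q ^ (nat (int s * (int s + 1) div 2) + (\<Sum>t\<le>r. nat ((2 ^ t * (2 * int s + 1))\<^sup>2 div 2)))"
    by (simp add: Q_def qpow_def power_add power_sum)
  finally show ?thesis
    unfolding Y_def by (rule nonneg_poly_q_power_cancel)
qed

text \<open>Half of \<open>K\<close> is \<open>p * k\<close>, which clears both denominators. The
  intended values are \<open>p = 2 ^ (n - 2)\<close>, \<open>k = 2 * \<nu> + 1\<close>,
  \<open>u = \<nu> + s + 1\<close>.\<close>

lemma G_exp_eq:
  assumes "p \<noteq> 0" "k \<noteq> 0" "of_int K = 2 * p * k"
  shows "G_exp (c * u / (p * k)) (c * (k - u) / (p * k)) K j
    = c * (of_int j * (k * of_int j + (2 * u - k)))"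
  using assms(1,2) unfolding G_exp_def assms(3) by (simp add: field_simps)

text \<open>With natural exponents, \<open>G_coeff\<close> is zero at every \<open>e\<close> outside
  the naturals and otherwise a polynomial coefficient. Enlarging the index set to \<open>J\<close>
  adds only zero binomials.\<close>

lemma G_nonneg_if_nonneg_poly:
  assumes "\<And>j. G_exp \<alpha> \<beta> K j = of_int (x j)" "\<And>j. 0 \<le> x j"
    and "finite J" "\<And>j. 0 \<le> N - K * j \<Longrightarrow> N - K * j \<le> M + N \<Longrightarrow> j \<in> J"
    and "nonneg_poly (\<Sum>j\<in>J. (- 1) ^ nat \<bar>j\<bar> * qpow (x j) * qbinom (M + N) (N - K * j))"
  shows "G_nonneg N M \<alpha> \<beta> K"
  unfolding G_nonneg_def
proof
  fix e
  have int_diff: "e - G_exp \<alpha> \<beta> K j \<in> \<nat> \<longleftrightarrow> e \<in> \<nat> \<and> nat (x j) \<le> nat \<lfloor>e\<rfloor>" for j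
  proof
    assume "e - G_exp \<alpha> \<beta> K j \<in> \<nat>"
    then obtain d where "e = of_nat (d + nat (x j))"
      using assms(1,2)[of j] by (auto simp: Nats_def algebra_simps)
    then show "e \<in> \<nat> \<and> nat (x j) \<le> nat \<lfloor>e\<rfloor>"
      by (simp add: nat_mono flip: of_nat_add)
  next
    assume "e \<in> \<nat> \<and> nat (x j) \<le> nat \<lfloor>e\<rfloor>"
    then obtain d where "e = of_nat d" "nat (x j) \<le> d" by (auto simp: Nats_def)
    then have "e - G_exp \<alpha> \<beta> K j = of_nat (d - nat (x j))"
      using assms(1,2)[of j] by (simp add: of_nat_diff)
    then show "e - G_exp \<alpha> \<beta> K j \<in> \<nat>" by simp
  qed
  show "0 \<le> G_coeff N M \<alpha> \<beta> K e"
  proof (cases "e \<in> \<nat>")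
    case True
    then obtain d where d: "e = of_nat d" by (auto simp: Nats_def)
    have "G_coeff N M \<alpha> \<beta> K e = (\<Sum>j\<in>{j. 0 \<le> N - K * j \<and> N - K * j \<le> M + N}.
        coeff ((- 1) ^ nat \<bar>j\<bar> * qpow (x j) * qbinom (M + N) (N - K * j)) d)"
      unfolding G_coeff_def
    proof (rule sum.cong[OF refl])
      fix j
      have "\<lfloor>e - G_exp \<alpha> \<beta> K j\<rfloor> = int d - x j"
        by (simp add: d assms(1))
      moreover have "coeff ((- 1) ^ nat \<bar>j\<bar> * p) d = (- 1) ^ nat \<bar>j\<bar> * coeff p d" for p :: "rat poly"
        by (cases "even (nat \<bar>j\<bar>)") simp_all
      ultimately show "(- 1) ^ nat \<bar>j\<bar> * (if e - G_exp \<alpha> \<beta> K j \<in> \<nat>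
          then coeff (qbinom (M + N) (N - K * j)) (nat \<lfloor>e - G_exp \<alpha> \<beta> K j\<rfloor>) else 0)
        = coeff ((- 1) ^ nat \<bar>j\<bar> * qpow (x j) * qbinom (M + N) (N - K * j)) d"
        using assms(2)[of j] unfolding int_diff
        by (simp add: mult.assoc qpow_def q_power coeff_monom_mult nat_diff_distrib d)
    qed
    also have "\<dots> = coeff (\<Sum>j\<in>J. (- 1) ^ nat \<bar>j\<bar> * qpow (x j) * qbinom (M + N) (N - K * j)) d"
      unfolding coeff_sum
    proof (rule sum.mono_neutral_left[OF assms(3)], use assms(4) in blast, intro ballI)
      fix j assume "j \<in> J - {j. 0 \<le> N - K * j \<and> N - K * j \<le> M + N}"
      then have "qbinom (M + N) (N - K * j) = 0" by (intro qbinom_eq_0) auto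
      then show "coeff ((- 1) ^ nat \<bar>j\<bar> * qpow (x j) * qbinom (M + N) (N - K * j)) d = 0" by simp
    qed
    also have "\<dots> \<ge> 0" using assms(5) by (simp add: nonneg_poly_def)
    finally show ?thesis .
  qed (simp add: G_coeff_def int_diff)
qed

theorem theorem2p5:
  fixes L \<nu> s n :: nat
  assumes "\<nu> > 0" and "s < \<nu>" and "n \<ge> 2"
  shows "G_nonneg
     (int L - 2^(n-1) * int s - 2^(n-2))
     (int L + 2^(n-1) * int s + 2^(n-2))
     ((((2^(2*n) - 1) / 3) * of_nat \<nu> + (2^(2*n-1) + 1) / 3) * (of_nat \<nu> + of_nat s + 1)
        / (2^(n-2) * (2 * of_nat \<nu> + 1)))
     ((((2^(2*n) - 1) / 3) * of_nat \<nu> + (2^(2*n-1) + 1) / 3) * (of_nat \<nu> - of_nat s)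
        / (2^(n-2) * (2 * of_nat \<nu> + 1)))
     (2^(n-1) * (2 * int \<nu> + 1))"
proof -
  obtain r where n: "n = r + 2" using assms(3) by (metis add.commute le_Suc_ex)
  define K where "K = 2 * int \<nu> + 1"
  define c where "c = int \<nu> + 1 + 2 * K * (\<Sum>t\<le>r. 4 ^ t)"
  define x where "x j = c * (j * (K * j + 2 * int s + 1))" for j
  let ?J = "{- 2 * int (Suc L)..2 * int (Suc L) + 1}"
  have "2 * n = 2 * r + 4" "2 * n - 1 = 2 * r + 3" "n - 1 = r + 1" "n - 2 = r"
    by (simp_all add: n)
  then have pow: "(2 :: rat) ^ (2 * n) = 16 * 4 ^ r" "(2 :: rat) ^ (2 * n - 1) = 8 * 4 ^ r"
    "(2 :: rat) ^ (n - 1) = 2 * 2 ^ r" "(2 :: int) ^ (n - 1) = 2 * 2 ^ r" "n - 2 = r"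
    by (simp_all only: power_add power_mult) simp_all
  \<comment> \<open>Summing the geometric series in \<open>c\<close> gives the constant of the
    theorem, as \<open>4 ^ (r + 2) = 2 ^ (2 * n)\<close>.\<close>
  have c: "((2 ^ (2 * n) - 1) / 3) * of_nat \<nu> + (2 ^ (2 * n - 1) + 1) / 3 = (of_int c :: rat)"
  proof -
    have S: "(\<Sum>t\<le>r. 4 ^ t) = (4 ^ Suc r - 1 :: rat) / 3"
      using geometric_sum_4[of r, where 'a = rat] by simp
    show ?thesis
      unfolding c_def K_def pow of_int_add of_int_mult of_int_sum of_int_power of_int_numeral S
      by (simp add: field_simps)
  qed
  have N: "int L - 2 ^ (n - 1) * int s - 2 ^ (n - 2) - 2 ^ (n - 1) * K * j
      = int L - 2 ^ r * (2 * (K * j + int s) + 1)" for j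
    unfolding pow by (simp add: algebra_simps)
  have NM: "int L + 2 ^ (n - 1) * int s + 2 ^ (n - 2) + (int L - 2 ^ (n - 1) * int s - 2 ^ (n - 2)) = 2 * int L"
    by simp
  show ?thesis
    unfolding c K_def[symmetric]
  proof (rule G_nonneg_if_nonneg_poly[where x = x and J = ?J], goal_cases)
    case (1 j)
    define k :: rat where "k = 2 * of_nat \<nu> + 1"
    have "k \<noteq> 0" by (simp add: k_def add_nonneg_eq_0_iff)
    moreover have "of_int (2 ^ (n - 1) * K) = 2 * 2 ^ r * k"
      by (simp only: pow of_int_mult) (simp add: k_def K_def)
    ultimately have "G_exp (of_int c * (of_nat \<nu> + of_nat s + 1) / (2 ^ r * k))
        (of_int c * (k - (of_nat \<nu> + of_nat s + 1)) / (2 ^ r * k)) (2 ^ (n - 1) * K) j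
      = of_int c * (of_int j * (k * of_int j + (2 * (of_nat \<nu> + of_nat s + 1) - k)))"
      by (intro G_exp_eq) simp_all
    moreover have "k - (of_nat \<nu> + of_nat s + 1) = of_nat \<nu> - of_nat s"
      "2 * (of_nat \<nu> + of_nat s + 1) - k = 2 * of_nat s + 1"
      by (simp_all add: k_def)
    moreover have "of_int (x j) = of_int c * (of_int j * (k * of_int j + (2 * of_nat s + 1)))"
      by (simp add: x_def K_def k_def add.assoc)
    ultimately show ?case
      unfolding k_def[symmetric] pow(5) by simp
  next
    case (2 j)
    have "0 \<le> c" by (simp add: c_def K_def sum_nonneg)
    then show ?case
      unfolding x_def K_def using quadratic_exponent_nonneg[OF assms(2)] by (rule mult_nonneg_nonneg)
  next
    case (4 j)
    define y where "y = 2 * (K * j + int s) + 1"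
    have "\<bar>2 ^ r * y\<bar> \<le> int L"
      using 4 unfolding N NM y_def by linarith
    moreover have "1 * \<bar>y\<bar> \<le> 2 ^ r * \<bar>y\<bar>" by (rule mult_right_mono) simp_all
    ultimately have y: "\<bar>y\<bar> \<le> int L" by (simp add: abs_mult)
    have "\<bar>j\<bar> \<le> \<bar>y\<bar>"
    proof (cases "0 \<le> j")
      case True
      then have "1 * j \<le> K * j" by (intro mult_right_mono) (simp_all add: K_def)
      then show ?thesis using True by (simp add: y_def)
    next
      case False
      \<comment> \<open>Added together, these give the bound on \<open>2 * (K * j)\<close>; with
        \<open>s < \<nu>\<close> it yields \<open>y \<le> j < 0\<close>.\<close>
      then have "(K - 1) * (j + 1) \<le> 0" "K * (j + 1) \<le> 0"
        by (auto intro!: mult_nonneg_nonpos simp: K_def)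
      then have "2 * (K * j) \<le> j + 1 - 2 * K" by (simp add: algebra_simps)
      also have "\<dots> \<le> j - 2 * int s - 1" using assms(2) by (simp add: K_def)
      finally have "y \<le> j" by (simp add: y_def)
      then show ?thesis using False by simp
    qed
    with y have "- int L \<le> j" "j \<le> int L" by linarith+
    then show ?case by simp
  next
    case 5
    show ?case
      using G_poly_nonneg[OF assms(2), of r L] unfolding N NM x_def c_def unfolding K_def .
  qed simp
qed

end
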